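(* Let $d\geq 1$, $T>0$, $x_0\in\mathbb{R}^d$, let $N$ be a positive integer and $\Delta t=T/N$. Let $M\geq d+1$ be an integer and let $f_1,\ldots,f_M:\mathbb{R}^d\to\mathbb{R}^d$ be differentiable functions. Let $K\geq 0$, $L>0$, $S>0$ be constants such that for all $1\leq i\leq M$ and all $x,z\in\mathbb{R}^d$ $$|f_i(x)-f_i(z)-f_i'(z)(x-z)|\leq S|x-z|^2,\qquad |f_i(x)|\leq K,\qquad |f_i'(x)|\leq L .$$ Let $F(x)=\{f_i(x)\}_{i=1}^M$ for $x\in\mathbb{R}^d$. Assume that $x:[0,T]\to\mathbb{R}^d$ is a solution to the differential inclusion $x'(t)\in F(x(t))$, $x(0)=x_0$. Then there exists a sequence $\{\xi_n\}_{n=0}^N$ in $\mathbb{R}^d$ solving the Forward Euler scheme $$\xi_{n+1}\in\xi_n+\Delta t\,F(\xi_n),\quad n=0,1,\ldots,N-1,\qquad \xi_0=x_0,$$ such that $$\begin{aligned}\max_{0\leq n\leq N}|x(n\Delta t)-\xi_n|\leq{}& \Big(e^{LT}\big(KLT+K(8M-10)\big)+2K(M-1)\Big)\Delta t\\ &+e^{LT}\Big(KL(M-1)(M-2)+2KL\frac{(M-1)^3-(M-1)}{3}(1+L\Delta t)^{M-3}\\ &\qquad\quad+2SK^2\frac{M(M-1)(2M-1)}{3L}\Big)\Delta t^2 .\end{aligned}$$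
   Context: $|\cdot|$ denotes the Euclidean norm when applied to a vector and the Euclidean operator norm when applied to a matrix; $f_i'(x)$ is the Jacobian matrix of $f_i$ at $x$. For a set $C\subset\mathbb{R}^d$, $c\in\mathbb{R}^d$ and $\lambda\geq0$, $c+\lambda C=\{c+\lambda y\mid y\in C\}$. A solution to the differential inclusion is an absolutely continuous function $x:[0,T]\to\mathbb{R}^d$ with $x(0)=x_0$ and $x'(t)\in F(x(t))$ for almost every $t\in[0,T]$. *)

theory Defs
  imports "HOL-Analysis.Analysis"
begin

(* Absolute continuity of a function on an interval (the library's absolutely_continuous is about
   measures).  Degenerate intervals u i = v i are allowed; they contribute nothing. *)
definition abs_continuous_on :: "real \<Rightarrow> real \<Rightarrow> (real \<Rightarrow> 'a::real_normed_vector) \<Rightarrow> bool" where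
  "abs_continuous_on a b x \<longleftrightarrow>
     (\<forall>\<epsilon>>0. \<exists>\<delta>>0. \<forall>(n::nat) (u::nat \<Rightarrow> real) (v::nat \<Rightarrow> real).
        (\<forall>i<n. a \<le> u i \<and> u i \<le> v i \<and> v i \<le> b) \<longrightarrow>
        disjoint_family_on (\<lambda>i. {u i<..<v i}) {..<n} \<longrightarrow>
        (\<Sum>i<n. v i - u i) < \<delta> \<longrightarrow>
        (\<Sum>i<n. norm (x (v i) - x (u i))) < \<epsilon>)"

definition diff_inclusion_solution ::
  "('a \<Rightarrow> 'a set) \<Rightarrow> real \<Rightarrow> 'a \<Rightarrow> (real \<Rightarrow> 'a::real_normed_vector) \<Rightarrow> bool" where
  "diff_inclusion_solution F T x0 x \<longleftrightarrow>
     abs_continuous_on 0 T x \<and> x 0 = x0 \<and>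
     (AE t in lebesgue_on {0..T}.
        \<exists>y \<in> F (x t). (x has_vector_derivative y) (at t within {0..T}))"

(* Only the values \<xi> 0, ..., \<xi> N are constrained. *)
definition forward_euler_solution ::
  "('a \<Rightarrow> 'a set) \<Rightarrow> real \<Rightarrow> nat \<Rightarrow> 'a \<Rightarrow> (nat \<Rightarrow> 'a::real_normed_vector) \<Rightarrow> bool" where
  "forward_euler_solution F \<Delta>t N x0 \<xi> \<longleftrightarrow>
     \<xi> 0 = x0 \<and> (\<forall>n<N. \<xi> (Suc n) \<in> {\<xi> n + \<Delta>t *\<^sub>R y | y. y \<in> F (\<xi> n)})"

(* Euclidean operator norm; the library's norm on matrices is the Frobenius norm. *)
definition matrix_op_norm :: "real^'n^'m \<Rightarrow> real" where
  "matrix_op_norm A = onorm (\<lambda>v. A *v v)"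

end

(* On a mesh interval [a, b] the difference quotient of x lies in the convex hull of the f_i(x a) up to
   K L (b - a), because an absolutely continuous curve whose derivative lies almost everywhere in a
   closed convex set has its difference quotients there too; so x performs Euler steps with convex
   weights.  Greedy rounding of the weights to unit vectors keeps the accumulated discrepancy at most
   2 (M - 1) in the l1 norm, and summation by parts with Gronwall's inequality turns this into the
   error bound exp (L T) K (4 M - 3) T / N.  This is below the claimed bound since M >= 2. *)
theory Submission
  imports Defs
begin

section \<open>Absolute continuity on tagged divisions\<close>

lemma abs_continuous_on_subset:
  assumes "abs_continuous_on a b x" "a \<le> a'" "b' \<le> b"
  shows "abs_continuous_on a' b' x"
  unfolding abs_continuous_on_def
proof (intro allI impI)
  fix e :: real assume "e > 0"
  then obtain d where "d > 0" and d: "\<And>(n::nat) u v. \<lbrakk>\<forall>i<n. a \<le> u i \<and> u i \<le> v i \<and> v i \<le> b;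
      disjoint_family_on (\<lambda>i. {u i<..<v i}) {..<n}; (\<Sum>i<n. v i - u i) < d\<rbrakk> \<Longrightarrow>
      (\<Sum>i<n. norm (x (v i) - x (u i))) < e"
    using assms(1) unfolding abs_continuous_on_def by meson
  show "\<exists>d>0. \<forall>(n::nat) u v. (\<forall>i<n. a' \<le> u i \<and> u i \<le> v i \<and> v i \<le> b') \<longrightarrow>
      disjoint_family_on (\<lambda>i. {u i<..<v i}) {..<n} \<longrightarrow> (\<Sum>i<n. v i - u i) < d \<longrightarrow>
      (\<Sum>i<n. norm (x (v i) - x (u i))) < e"
    using \<open>d > 0\<close> assms(2,3) by (intro exI[of _ d] conjI allI impI d) (auto intro: order_trans)
qed

lemma negligible_open_cover:
  fixes E :: "real set"
  assumes "negligible E" "e > 0"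
  obtains U where "open U" "E \<subseteq> U" "U \<in> lmeasurable" "measure lebesgue U < e"
proof -
  have E: "E \<in> null_sets lebesgue"
    using assms(1) negligible_iff_null_sets by blast
  obtain U where U: "open U" "E \<subseteq> U" "U - E \<in> lmeasurable" "emeasure lebesgue (U - E) < ennreal e"
    using sets_lebesgue_outer_open[of E e] E assms(2) by blast
  have "emeasure lebesgue U = emeasure lebesgue (U - E)"
    using emeasure_Diff_null_set[OF E] U(1) by simp
  then have lt: "emeasure lebesgue U < ennreal e"
    using U(4) by simp
  moreover have "U \<in> lmeasurable"
    using lt U(1) by (intro fmeasurableI) (auto intro: less_trans)
  ultimately show thesis
    using that[OF U(1,2)] assms(2) by (auto simp: emeasure_eq_measure2 ennreal_less_iff)
qed

text \<open>Endpoints are written \<open>Inf k\<close> and \<open>Sup k\<close> because the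
  telescoping rule \<open>additive_tagged_division_1\<close> states its increments in that
  form.\<close>

lemma tagged_partial_division_interval:
  fixes p :: "(real \<times> real set) set"
  assumes "p tagged_partial_division_of {a..b}" "(t, k) \<in> p"
  shows "k = {Inf k..Sup k}" "Inf k \<le> t" "t \<le> Sup k" "a \<le> Inf k" "Sup k \<le> b"
proof -
  have "t \<in> k" "k \<subseteq> {a..b}"
    using tagged_partial_division_ofD[OF assms(1)] assms(2) by auto
  moreover obtain u v where "k = {u..v}"
    using tagged_partial_division_ofD(4)[OF assms(1)] assms(2) by force
  ultimately show "k = {Inf k..Sup k}" "Inf k \<le> t" "t \<le> Sup k" "a \<le> Inf k" "Sup k \<le> b"
    by auto
qed

text \<open>The form of absolute continuity needed near a null set: intervals of \<open>q\<close>
  inside \<open>U\<close> have disjoint interiors, so their total length is at most the measure of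
  \<open>U\<close>, and a small \<open>U\<close> forces a small variation. One \<open>d\<close>
  serves all \<open>q\<close> and \<open>U\<close>.\<close>

lemma abs_continuous_on_tagged_partial_division:
  assumes "abs_continuous_on a b x" "e > 0"
  shows "\<exists>d>0. \<forall>q U. q tagged_partial_division_of {a..b} \<longrightarrow> (\<forall>(t,k)\<in>q. k \<subseteq> U) \<longrightarrow>
      U \<in> lmeasurable \<longrightarrow> measure lebesgue U < d \<longrightarrow>
      (\<Sum>(t,k)\<in>q. Sup k - Inf k) \<le> measure lebesgue U \<and>
      (\<Sum>(t,k)\<in>q. norm (x (Sup k) - x (Inf k))) < e"
proof -
  obtain d where "d > 0" and d: "\<And>(n::nat) u v. \<lbrakk>\<forall>i<n. a \<le> u i \<and> u i \<le> v i \<and> v i \<le> b;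
      disjoint_family_on (\<lambda>i. {u i<..<v i}) {..<n}; (\<Sum>i<n. v i - u i) < d\<rbrakk> \<Longrightarrow>
      (\<Sum>i<n. norm (x (v i) - x (u i))) < e"
    using assms unfolding abs_continuous_on_def by meson
  have "(\<Sum>(t,k)\<in>q. Sup k - Inf k) \<le> measure lebesgue U \<and>
      (\<Sum>(t,k)\<in>q. norm (x (Sup k) - x (Inf k))) < e"
    if q: "q tagged_partial_division_of {a..b}" and sub: "\<forall>(t,k)\<in>q. k \<subseteq> U"
      and U: "U \<in> lmeasurable" "measure lebesgue U < d" for q U
  proof -
    note q_int = tagged_partial_division_interval[OF q]
    have "finite q"
      using q by (rule tagged_partial_division_ofD)
    then obtain h where h: "bij_betw h {..<card q} q"
      using ex_bij_betw_nat_finite by (metis atLeast0LessThan)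
    define u v where "u i = Inf (snd (h i))" and "v i = Sup (snd (h i))" for i
    have hq: "(fst (h i), snd (h i)) \<in> q" if "i < card q" for i
      using h that by (auto simp: bij_betw_def)
    have uv: "\<forall>i<card q. a \<le> u i \<and> u i \<le> v i \<and> v i \<le> b"
      using q_int[OF hq] unfolding u_def v_def by (meson order_trans)
    have int: "interior (snd (h i)) = {u i<..<v i}" if "i < card q" for i
      using q_int(1)[OF hq[OF that]] interior_atLeastAtMost_real unfolding u_def v_def by metis
    have disj: "disjoint_family_on (\<lambda>i. {u i<..<v i}) {..<card q}"
      unfolding disjoint_family_on_def
    proof (intro ballI impI)
      fix i j assume ij: "i \<in> {..<card q}" "j \<in> {..<card q}" "i \<noteq> j"
      then have "h i \<noteq> h j"
        using h by (auto simp: bij_betw_def inj_on_def)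
      then have "interior (snd (h i)) \<inter> interior (snd (h j)) = {}"
        using tagged_partial_division_ofD(5)[OF q hq hq, of i j] ij by (simp add: prod_eq_iff)
      then show "{u i<..<v i} \<inter> {u j<..<v j} = {}"
        using int ij by simp
    qed
    \<comment> \<open>Neighbouring intervals may share endpoints, so lengths are added through the
      disjoint open interiors.\<close>
    have "(\<Sum>i<card q. v i - u i) = (\<Sum>i<card q. measure lebesgue {u i<..<v i})"
      using uv by (intro sum.cong) auto
    also have "\<dots> = measure lebesgue (\<Union>i<card q. {u i<..<v i})"
      using disj uv by (intro measure_finite_Union[symmetric]) auto
    also have "\<dots> \<le> measure lebesgue U"
    proof (rule measure_mono_fmeasurable[OF _ _ U(1)])
      show "(\<Union>i<card q. {u i<..<v i}) \<subseteq> U"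
        using sub hq int interior_subset by blast
    qed auto
    finally have len: "(\<Sum>i<card q. v i - u i) \<le> measure lebesgue U" .
    have "(\<Sum>(t,k)\<in>q. Sup k - Inf k) = (\<Sum>i<card q. v i - u i)"
      "(\<Sum>(t,k)\<in>q. norm (x (Sup k) - x (Inf k))) = (\<Sum>i<card q. norm (x (v i) - x (u i)))"
      unfolding u_def v_def by (simp_all add: sum.reindex_bij_betw[OF h, symmetric] case_prod_beta)
    then show ?thesis
      using len d[OF uv disj] U(2) by simp
  qed
  then show ?thesis
    using \<open>d > 0\<close> by blast
qed

section \<open>Mean value theorem for absolutely continuous curves and closed convex sets\<close>

text \<open>Because \<open>t\<close> lies between \<open>u\<close> and \<open>v\<close>, the errors
  of the increments from \<open>t\<close> to \<open>v\<close> and from \<open>t\<close> to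
  \<open>u\<close> add up to \<open>e\<close> times
  \<open>(v - t) + (t - u) = v - u\<close>.\<close>

lemma vector_derivative_straddle:
  fixes x :: "real \<Rightarrow> 'a::real_inner"
  assumes "(x has_vector_derivative y) (at t within {a..b})" "e > 0"
  shows "\<exists>d>0. \<forall>u v. u \<le> t \<longrightarrow> t \<le> v \<longrightarrow> {u..v} \<subseteq> {a..b} \<longrightarrow> {u..v} \<subseteq> ball t d \<longrightarrow>
    norm (x v - x u - (v - u) *\<^sub>R y) \<le> e * (v - u)"
proof -
  obtain d where "d > 0" and d: "\<And>s. \<lbrakk>s \<in> {a..b}; norm (s - t) < d\<rbrakk> \<Longrightarrow>
      norm (x s - x t - (s - t) *\<^sub>R y) \<le> e * norm (s - t)"
    using assms unfolding has_vector_derivative_def has_derivative_within_alt by blast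
  have "norm (x v - x u - (v - u) *\<^sub>R y) \<le> e * (v - u)"
    if "u \<le> t" "t \<le> v" "{u..v} \<subseteq> {a..b}" "{u..v} \<subseteq> ball t d" for u v
  proof -
    have "u \<in> {u..v}" "v \<in> {u..v}"
      using that by auto
    then have "u \<in> {a..b}" "v \<in> {a..b}" "u \<in> ball t d" "v \<in> ball t d"
      using that(3,4) by blast+
    then have "norm (x v - x t - (v - t) *\<^sub>R y) \<le> e * (v - t)"
      "norm (x u - x t - (u - t) *\<^sub>R y) \<le> e * (t - u)"
      using d[of v] d[of u] that(1,2) by (auto simp: dist_real_def)
    moreover have "x v - x u - (v - u) *\<^sub>R y =
        (x v - x t - (v - t) *\<^sub>R y) - (x u - x t - (u - t) *\<^sub>R y)"
      by (simp add: algebra_simps)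
    ultimately show ?thesis
      using norm_triangle_ineq4[of "x v - x t - (v - t) *\<^sub>R y" "x u - x t - (u - t) *\<^sub>R y"]
      by (simp add: algebra_simps)
  qed
  then show ?thesis
    using \<open>d > 0\<close> by blast
qed

text \<open>On a fine tagged division, the intervals tagged outside the null set obey the derivative
  bound, while those tagged inside it have small total length and, by absolute continuity,
  contribute little.\<close>

lemma abs_continuous_increment_le:
  fixes x :: "real \<Rightarrow> 'a::real_inner"
  assumes "a \<le> b" and ac: "abs_continuous_on a b x" and "negligible E"
    and der: "\<And>t. t \<in> {a..b} - E \<Longrightarrow>
      \<exists>y. l \<bullet> y \<le> c \<and> (x has_vector_derivative y) (at t within {a..b})"
  shows "l \<bullet> (x b - x a) \<le> c * (b - a)"
proof -
  \<comment> \<open>The three terms come from the intervals tagged outside \<open>E\<close>, from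
    the variation over those tagged in \<open>E\<close>, and from the length of the latter.\<close>
  define A where "A = norm l * (b - a) + norm l + \<bar>c\<bar>"
  have "A \<ge> 0"
    using \<open>a \<le> b\<close> by (simp add: A_def)
  \<comment> \<open>The excess of the increment over the claimed bound. It is additive over a
    division, so its sum is the excess on \<open>{a..b}\<close>.\<close>
  define H where "H k = l \<bullet> (x (Sup k) - x (Inf k)) - c * (Sup k - Inf k)" for k
  have bound: "l \<bullet> (x b - x a) - c * (b - a) \<le> A * e" if "e > 0" for e
  proof -
    obtain d where "d > 0" and d: "\<And>q U. \<lbrakk>q tagged_partial_division_of {a..b};
        \<forall>(t,k)\<in>q. k \<subseteq> U; U \<in> lmeasurable; measure lebesgue U < d\<rbrakk> \<Longrightarrow>
        (\<Sum>(t,k)\<in>q. Sup k - Inf k) \<le> measure lebesgue U \<and>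
        (\<Sum>(t,k)\<in>q. norm (x (Sup k) - x (Inf k))) < e"
      using abs_continuous_on_tagged_partial_division[OF ac \<open>e > 0\<close>] by blast
    \<comment> \<open>Measure below \<open>d\<close> brings absolute continuity into play; measure
      below \<open>e\<close> bounds the total length of the intervals tagged in
      \<open>E\<close>.\<close>
    obtain U where U: "open U" "E \<subseteq> U" "U \<in> lmeasurable" "measure lebesgue U < min d e"
      using negligible_open_cover[OF \<open>negligible E\<close>, of "min d e"] \<open>d > 0\<close> \<open>e > 0\<close> by auto
    have "\<exists>r>0. \<forall>u v. u \<le> t \<longrightarrow> t \<le> v \<longrightarrow> {u..v} \<subseteq> {a..b} \<longrightarrow> {u..v} \<subseteq> ball t r \<longrightarrow>
        l \<bullet> (x v - x u) - c * (v - u) \<le> norm l * e * (v - u)"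
      if t: "t \<in> {a..b} - E" for t
    proof -
      obtain y where y: "l \<bullet> y \<le> c" "(x has_vector_derivative y) (at t within {a..b})"
        using der[OF t] by blast
      obtain r where "r > 0" and r: "\<And>u v. \<lbrakk>u \<le> t; t \<le> v; {u..v} \<subseteq> {a..b}; {u..v} \<subseteq> ball t r\<rbrakk> \<Longrightarrow>
          norm (x v - x u - (v - u) *\<^sub>R y) \<le> e * (v - u)"
        using vector_derivative_straddle[OF y(2) \<open>e > 0\<close>] by blast
      have "l \<bullet> (x v - x u) - c * (v - u) \<le> norm l * e * (v - u)"
        if uv: "u \<le> t" "t \<le> v" "{u..v} \<subseteq> {a..b}" "{u..v} \<subseteq> ball t r" for u v
      proof -
        have "l \<bullet> (x v - x u - (v - u) *\<^sub>R y) \<le> norm l * (e * (v - u))"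
          using norm_cauchy_schwarz r[OF uv] by (meson mult_left_mono norm_ge_zero order_trans)
        moreover have "(l \<bullet> y) * (v - u) \<le> c * (v - u)"
          using y(1) uv by (intro mult_right_mono) auto
        ultimately show ?thesis
          by (simp add: inner_diff_right algebra_simps)
      qed
      then show ?thesis
        using \<open>r > 0\<close> by blast
    qed
    then obtain r where r0: "\<And>t. t \<in> {a..b} - E \<Longrightarrow> r t > 0"
      and r: "\<And>t u v. \<lbrakk>t \<in> {a..b} - E; u \<le> t; t \<le> v; {u..v} \<subseteq> {a..b}; {u..v} \<subseteq> ball t (r t)\<rbrakk> \<Longrightarrow>
        l \<bullet> (x v - x u) - c * (v - u) \<le> norm l * e * (v - u)"
      by metis
    \<comment> \<open>Fineness keeps intervals tagged in \<open>E\<close> inside \<open>U\<close>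
      and all others inside the radius where the derivative estimate holds. The last case only makes
      \<open>g\<close> a gauge on the whole line.\<close>
    define g where "g t = (if t \<in> E then U else if t \<in> {a..b} then ball t (r t) else ball t 1)" for t
    have "gauge g"
      using U r0 by (auto simp: gauge_def g_def)
    then obtain p where p: "p tagged_division_of {a..b}" "g fine p"
      using fine_division_exists_real by blast
    have pp: "p tagged_partial_division_of {a..b}"
      using p(1) tagged_division_of_def by blast
    have "finite p"
      using p(1) by auto
    note p_int = tagged_partial_division_interval[OF pp]
    define q where "q = {(t,k) \<in> p. t \<in> E}"
    have "q \<subseteq> p"
      by (auto simp: q_def)
    then have qp: "q tagged_partial_division_of {a..b}"
      using pp tagged_partial_division_subset by blast
    have "\<forall>(t,k)\<in>q. k \<subseteq> U"
      using fineD[OF p(2)] by (fastforce simp: q_def g_def)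
    with d[OF qp _ U(3)] U(4) have q: "(\<Sum>(t,k)\<in>q. Sup k - Inf k) \<le> e"
      "(\<Sum>(t,k)\<in>q. norm (x (Sup k) - x (Inf k))) \<le> e"
      by (auto simp: less_imp_le intro: order_trans)
    have "(\<Sum>(t,k)\<in>q. H k) \<le>
        (\<Sum>(t,k)\<in>q. norm l * norm (x (Sup k) - x (Inf k)) + \<bar>c\<bar> * (Sup k - Inf k))"
    proof (rule sum_mono, clarify)
      fix t k assume "(t,k) \<in> q"
      then have "Inf k \<le> Sup k"
        using p_int(2,3) \<open>q \<subseteq> p\<close> by (meson order_trans subsetD)
      then have "- c * (Sup k - Inf k) \<le> \<bar>c\<bar> * (Sup k - Inf k)"
        by (intro mult_right_mono) auto
      then show "H k \<le> norm l * norm (x (Sup k) - x (Inf k)) + \<bar>c\<bar> * (Sup k - Inf k)"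
        using norm_cauchy_schwarz[of l "x (Sup k) - x (Inf k)"] by (simp add: H_def)
    qed
    also have "\<dots> = norm l * (\<Sum>(t,k)\<in>q. norm (x (Sup k) - x (Inf k))) +
        \<bar>c\<bar> * (\<Sum>(t,k)\<in>q. Sup k - Inf k)"
      by (simp add: case_prod_beta sum.distrib sum_distrib_left)
    also have "\<dots> \<le> norm l * e + \<bar>c\<bar> * e"
      using q by (intro add_mono mult_left_mono) auto
    finally have q_le: "(\<Sum>(t,k)\<in>q. H k) \<le> norm l * e + \<bar>c\<bar> * e" .
    have "(\<Sum>(t,k)\<in>p - q. H k) \<le> (\<Sum>(t,k)\<in>p - q. norm l * e * (Sup k - Inf k))"
    proof (rule sum_mono, clarify)
      fix t k assume "(t,k) \<in> p" "(t,k) \<notin> q"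
      then have tk: "(t,k) \<in> p" "t \<notin> E"
        by (auto simp: q_def)
      then have "t \<in> {a..b}"
        using p_int[OF tk(1)] by auto
      then have "k \<subseteq> ball t (r t)"
        using fineD[OF p(2) tk(1)] tk(2) by (simp add: g_def)
      then have "{Inf k..Sup k} \<subseteq> ball t (r t)"
        using p_int(1)[OF tk(1)] by simp
      moreover have "{Inf k..Sup k} \<subseteq> {a..b}"
        using p_int(4,5)[OF tk(1)] by simp
      ultimately show "H k \<le> norm l * e * (Sup k - Inf k)"
        unfolding H_def using r[OF _ p_int(2,3)[OF tk(1)]] tk(2) \<open>t \<in> {a..b}\<close> by blast
    qed
    also have "\<dots> \<le> (\<Sum>(t,k)\<in>p. norm l * e * (Sup k - Inf k))"
    proof (rule sum_mono2[OF \<open>finite p\<close>])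
      fix z assume "z \<in> p - (p - q)"
      then have "Inf (snd z) \<le> Sup (snd z)"
        using p_int(2,3)[of "fst z" "snd z"] by auto
      then show "0 \<le> (case z of (t,k) \<Rightarrow> norm l * e * (Sup k - Inf k))"
        using \<open>e > 0\<close> by (simp add: case_prod_beta)
    qed auto
    also have "\<dots> = norm l * e * (b - a)"
      using additive_tagged_division_1[OF \<open>a \<le> b\<close> p(1), of "\<lambda>t. t"]
      by (simp add: case_prod_beta flip: sum_distrib_left)
    finally have pq_le: "(\<Sum>(t,k)\<in>p - q. H k) \<le> norm l * e * (b - a)" .
    have "l \<bullet> (x b - x a) - c * (b - a) = (\<Sum>(t,k)\<in>p. H k)"
      using additive_tagged_division_1[OF \<open>a \<le> b\<close> p(1), of "\<lambda>t. l \<bullet> x t - c * t"]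
      by (simp add: H_def inner_diff_right algebra_simps)
    also have "\<dots> = (\<Sum>(t,k)\<in>p - q. H k) + (\<Sum>(t,k)\<in>q. H k)"
      using sum.subset_diff[OF \<open>q \<subseteq> p\<close> \<open>finite p\<close>] by blast
    finally show ?thesis
      using q_le pq_le by (simp add: A_def algebra_simps)
  qed
  \<comment> \<open>Rescaling by \<open>A + 1\<close> instead of \<open>A\<close> avoids division by
    zero.\<close>
  have "l \<bullet> (x b - x a) - c * (b - a) \<le> 0 + e" if "e > 0" for e
  proof -
    have "A * (e / (A + 1)) \<le> e"
      using \<open>A \<ge> 0\<close> that by (simp add: field_simps)
    then show ?thesis
      using bound[of "e / (A + 1)"] \<open>A \<ge> 0\<close> that by (simp add: order_trans)
  qed
  then show ?thesis
    using field_le_epsilon[of "l \<bullet> (x b - x a) - c * (b - a)" 0] by simp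
qed

text \<open>A closed convex set is cut out by half-spaces. A difference quotient outside
  \<open>C\<close> would be strictly separated from it by a linear functional, whose increment
  contradicts the scalar estimate.\<close>

lemma abs_continuous_mean_value_convex:
  fixes x :: "real \<Rightarrow> 'a::euclidean_space"
  assumes "a < b" "abs_continuous_on a b x" "negligible E" "convex C" "closed C"
    and der: "\<And>t. t \<in> {a..b} - E \<Longrightarrow>
      \<exists>y\<in>C. (x has_vector_derivative y) (at t within {a..b})"
  shows "(x b - x a) /\<^sub>R (b - a) \<in> C"
proof (rule ccontr)
  assume "(x b - x a) /\<^sub>R (b - a) \<notin> C"
  then obtain l c where l: "l \<bullet> ((x b - x a) /\<^sub>R (b - a)) < c" "\<And>y. y \<in> C \<Longrightarrow> l \<bullet> y > c"
    using separating_hyperplane_closed_point[OF assms(4,5)] by blast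
  \<comment> \<open>The signs are flipped because the scalar estimate bounds increments from above,
    while \<open>l\<close> exceeds \<open>c\<close> on \<open>C\<close>.\<close>
  have "- l \<bullet> (x b - x a) \<le> - c * (b - a)"
  proof (rule abs_continuous_increment_le[OF _ assms(2,3)])
    fix t assume "t \<in> {a..b} - E"
    then show "\<exists>y. - l \<bullet> y \<le> - c \<and> (x has_vector_derivative y) (at t within {a..b})"
      using der[of t] l(2) by (force simp: less_imp_le)
  qed (use \<open>a < b\<close> in simp)
  moreover have "l \<bullet> (x b - x a) < c * (b - a)"
    using l(1) \<open>a < b\<close> unfolding inner_scaleR_right by (simp add: field_simps)
  ultimately show False
    by simp
qed

section \<open>Convex weights and their rounding\<close>

text \<open>Weights are attached to indices, not to points, since different fields may take the same
  value at a point. The set of all such combinations is convex and contains the generators, hence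
  contains the hull.\<close>

lemma in_convex_hull_image_weights:
  assumes "finite I" "y \<in> convex hull (g ` I)"
  obtains w where "\<And>i. i \<in> I \<Longrightarrow> w i \<ge> (0::real)" "sum w I = 1" "y = (\<Sum>i\<in>I. w i *\<^sub>R g i)"
proof -
  define C where "C = {\<Sum>i\<in>I. w i *\<^sub>R g i |w. (\<forall>i\<in>I. w i \<ge> (0::real)) \<and> sum w I = 1}"
  have "convex C"
    unfolding convex_def
  proof (intro ballI allI impI)
    fix p q and s t :: real
    assume pq: "p \<in> C" "q \<in> C" and st: "0 \<le> s" "0 \<le> t" "s + t = 1"
    from pq obtain v w where v: "\<forall>i\<in>I. v i \<ge> 0" "sum v I = 1" "p = (\<Sum>i\<in>I. v i *\<^sub>R g i)"
      and w: "\<forall>i\<in>I. w i \<ge> 0" "sum w I = 1" "q = (\<Sum>i\<in>I. w i *\<^sub>R g i)"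
      unfolding C_def by blast
    have "s *\<^sub>R p + t *\<^sub>R q = (\<Sum>i\<in>I. (s * v i + t * w i) *\<^sub>R g i)"
      by (simp add: v w scaleR_sum_right scaleR_add_left sum.distrib)
    moreover have "\<forall>i\<in>I. s * v i + t * w i \<ge> 0" "(\<Sum>i\<in>I. s * v i + t * w i) = 1"
      using st v w by (auto simp: sum.distrib simp flip: sum_distrib_left)
    ultimately show "s *\<^sub>R p + t *\<^sub>R q \<in> C"
      unfolding C_def by (auto intro!: exI[of _ "\<lambda>i. s * v i + t * w i"])
  qed
  moreover have "g ` I \<subseteq> C"
  proof clarify
    fix i assume "i \<in> I"
    then show "g i \<in> C"
      unfolding C_def using assms(1)
      by (auto intro!: exI[of _ "\<lambda>j. of_bool (j = i)"] simp: if_distrib[of "\<lambda>c. c *\<^sub>R _"] of_bool_def cong: if_cong)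
  qed
  ultimately have "y \<in> C"
    using assms(2) hull_minimal[of "g ` I" C convex] by blast
  then show thesis
    unfolding C_def using that by blast
qed

text \<open>Always rounding the currently largest accumulated weight, which is at least its mean
  \<open>1 / card I\<close>, keeps every discrepancy above \<open>-1\<close>.\<close>

lemma greedy_rounding:
  fixes w :: "nat \<Rightarrow> 'i \<Rightarrow> real"
  assumes I: "finite I" "I \<noteq> {}"
    and w: "\<And>n i. i \<in> I \<Longrightarrow> w n i \<ge> 0" "\<And>n. sum (w n) I = 1"
  obtains c D where "\<And>n. c n \<in> I" "\<And>i. D 0 i = 0"
    "\<And>n i. D (Suc n) i = D n i + w n i - of_bool (i = c n)"
    "\<And>n. (\<Sum>i\<in>I. \<bar>D n i\<bar>) \<le> 2 * (real (card I) - 1)"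
proof -
  define P where "P v i \<longleftrightarrow> i \<in> I \<and> (\<forall>j\<in>I. v j \<le> v i)" for v :: "'i \<Rightarrow> real" and i
  have "\<exists>i. P v i" for v
  proof -
    have "Max (v ` I) \<in> v ` I"
      using I by (intro Max_in) auto
    then show ?thesis
      unfolding P_def using I by (metis (no_types, lifting) Max_ge finite_imageI imageE imageI)
  qed
  then obtain pick where pick: "\<And>v. P v (pick v)"
    by metis
  \<comment> \<open>\<open>D n i\<close> is the accumulated weight of \<open>i\<close> minus the
    number of times \<open>i\<close> was chosen in the first \<open>n\<close> steps.\<close>
  define D where "D = rec_nat (\<lambda>_. 0)
    (\<lambda>n v i. v i + w n i - of_bool (i = pick (\<lambda>j. v j + w n j)))"
  define c where "c n = pick (\<lambda>j. D n j + w n j)" for n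
  have D0: "D 0 i = 0" for i
    by (simp add: D_def)
  have DS: "D (Suc n) i = D n i + w n i - of_bool (i = c n)" for n i
    by (simp add: D_def c_def)
  have cI: "c n \<in> I" and cmax: "i \<in> I \<Longrightarrow> D n i + w n i \<le> D n (c n) + w n (c n)" for n i
    using pick[of "\<lambda>j. D n j + w n j"] by (auto simp: P_def c_def)
  have sum0: "(\<Sum>i\<in>I. D n i) = 0" for n
  proof (induction n)
    case (Suc n)
    have "(\<Sum>i\<in>I. of_bool (i = c n)) = (1::real)"
      using I cI by (simp add: of_bool_def)
    with Suc w(2)[of n] show ?case
      by (simp add: DS sum.distrib sum_subtractf del: sum_of_bool_eq)
  qed (simp add: D0)
  have low: "D n i \<ge> -1" if "i \<in> I" for n i
    using that
  proof (induction n arbitrary: i)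
    case (Suc n)
    \<comment> \<open>The updated entries sum to 1, so the largest is nonnegative; all other entries
      can only grow.\<close>
    have "0 \<le> D n (c n) + w n (c n)"
    proof (rule ccontr)
      assume "\<not> 0 \<le> D n (c n) + w n (c n)"
      then have "(\<Sum>i\<in>I. D n i + w n i) \<le> (\<Sum>i\<in>I. 0)"
        using cmax[of _ n] by (intro sum_mono) force
      then show False
        using sum0[of n] w(2)[of n] by (simp add: sum.distrib)
    qed
    then show ?case
      using Suc.IH[OF Suc.prems] w(1)[OF Suc.prems, of n] by (cases "i = c n") (auto simp: DS)
  qed (simp add: D0)
  have "(\<Sum>i\<in>I. \<bar>D n i\<bar>) \<le> 2 * (real (card I) - 1)" for n
  proof -
    obtain j where j: "j \<in> I" "D n j \<ge> 0"
    proof -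
      have "\<exists>j\<in>I. D n j \<ge> 0"
      proof (rule ccontr)
        assume "\<not> (\<exists>j\<in>I. D n j \<ge> 0)"
        then have "(\<Sum>i\<in>I. D n i) < (\<Sum>i\<in>I. 0)"
          using I by (intro sum_strict_mono) auto
        then show False
          using sum0 by simp
      qed
      then show thesis
        using that by blast
    qed
    \<comment> \<open>An entry that is at least -1 has modulus at most itself plus 2. The
      nonnegative entry \<open>j\<close> needs no correction, which saves one 2; the entries
      themselves sum to zero.\<close>
    have "(\<Sum>i\<in>I. \<bar>D n i\<bar>) \<le> (\<Sum>i\<in>I. D n i + 2 * of_bool (i \<noteq> j))"
      using low[of _ n] j by (intro sum_mono) (force simp: of_bool_def)
    also have "\<dots> = 2 * (\<Sum>i\<in>I. of_bool (i \<noteq> j))"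
      using sum0 by (simp add: sum.distrib sum_distrib_left del: sum_of_bool_eq)
    also have "(\<Sum>i\<in>I. of_bool (i \<noteq> j)) = (\<Sum>i\<in>I - {j}. (1::real))"
      using I j by (intro sum.mono_neutral_cong_right) auto
    also have "\<dots> = real (card I) - 1"
      using j I by (simp add: of_nat_diff Suc_leI card_gt_0_iff)
    finally show ?thesis .
  qed
  then show thesis
    using that cI D0 DS by blast
qed

section \<open>Gronwall recursion for the Euler error\<close>

text \<open>Discrete Gronwall: \<open>- b\<close> is a fixed point of the map sending
  \<open>y\<close> to \<open>(1 + a) * y + a * b\<close>, so \<open>u n + b\<close> grows at most by
  the factor \<open>1 + a\<close>.\<close>

lemma affine_recurrence_le:
  fixes u :: "nat \<Rightarrow> real"
  assumes "a \<ge> 0" "b \<ge> 0" "u 0 \<le> 0" "\<And>n. n < N \<Longrightarrow> u (Suc n) \<le> (1 + a) * u n + a * b" "n \<le> N"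
  shows "u n \<le> (exp (a * n) - 1) * b"
proof -
  have "u n \<le> ((1 + a) ^ n - 1) * b"
    using \<open>n \<le> N\<close>
  proof (induction n)
    case (Suc n)
    then have "u (Suc n) \<le> (1 + a) * (((1 + a) ^ n - 1) * b) + a * b"
      using assms(1) assms(4)[of n] by (smt (verit) Suc_le_lessD mult_left_mono less_imp_le)
    then show ?case
      by (simp add: algebra_simps)
  qed (use assms(3) in simp)
  also have "(1 + a) ^ n \<le> exp a ^ n"
    using assms(1) by (intro power_mono) (auto simp: exp_ge_add_one_self)
  then have "((1 + a) ^ n - 1) * b \<le> (exp (a * n) - 1) * b"
    using assms(2) by (intro mult_right_mono) (auto simp: exp_of_nat2_mult)
  finally show ?thesis .
qed

text \<open>Summation by parts: the discrepancy term \<open>\<Sum>i. D n i *\<^sub>R f i (X n)\<close> is subtracted from the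
  error, and only its drift through the Lipschitz dependence of \<open>f i (X n)\<close> on \<open>n\<close> enters the
  Gronwall recursion.\<close>

lemma euler_discrepancy_error:
  fixes X \<xi> :: "nat \<Rightarrow> 'a::real_normed_vector"
  assumes "finite I" "h \<ge> 0" "L \<ge> 0" "K \<ge> 0"
    and bd: "\<And>i y. i \<in> I \<Longrightarrow> norm (f i y) \<le> K"
    and lip: "\<And>i y z. i \<in> I \<Longrightarrow> norm (f i y - f i z) \<le> L * norm (y - z)"
    and c: "\<And>n. c n \<in> I" and D0: "\<And>i. D 0 i = 0"
    and DS: "\<And>n i. D (Suc n) i = D n i + w n i - of_bool (i = c n)"
    and DB: "\<And>n. (\<Sum>i\<in>I. \<bar>D n i\<bar>) \<le> B"
    and X1: "\<And>n. n < N \<Longrightarrow> norm (X (Suc n) - X n) \<le> K * h"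
    and X2: "\<And>n. n < N \<Longrightarrow>
      norm (X (Suc n) - X n - h *\<^sub>R (\<Sum>i\<in>I. w n i *\<^sub>R f i (X n))) \<le> K * L * h\<^sup>2"
    and \<xi>0: "\<xi> 0 = X 0" and \<xi>S: "\<And>n. \<xi> (Suc n) = \<xi> n + h *\<^sub>R f (c n) (\<xi> n)"
    and "n \<le> N"
  shows "norm (X n - \<xi> n) \<le> exp (L * h * n) * (K * (2 * B + 1) * h)"
proof -
  define E where "E n = h *\<^sub>R (\<Sum>i\<in>I. D n i *\<^sub>R f i (X n))" for n
  define W where "W n = X n - \<xi> n - E n" for n
  have "B \<ge> 0"
    using DB[of 0] D0 by simp
  have sum_bd: "norm (\<Sum>i\<in>I. D n i *\<^sub>R v i) \<le> B * r" if "\<And>i. i \<in> I \<Longrightarrow> norm (v i) \<le> r" "r \<ge> 0"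
    for n r and v :: "'b \<Rightarrow> 'a"
  proof -
    have "norm (\<Sum>i\<in>I. D n i *\<^sub>R v i) \<le> (\<Sum>i\<in>I. \<bar>D n i\<bar> * r)"
      using that by (intro sum_norm_le) (auto intro: mult_left_mono)
    also have "\<dots> \<le> B * r"
      using DB[of n] that(2) by (simp add: mult_right_mono flip: sum_distrib_right)
    finally show ?thesis .
  qed
  have E_bd: "norm (E n) \<le> B * K * h" for n
    using sum_bd[OF bd] \<open>K \<ge> 0\<close> \<open>h \<ge> 0\<close> by (simp add: E_def mult_left_mono mult.commute)
  have W_step: "norm (W (Suc n)) \<le> (1 + L * h) * norm (W n) + L * h * (K * (2 * B + 1) * h)"
    if "n < N" for n
  proof -
    \<comment> \<open>\<open>R1\<close> is the averaging residual, \<open>R2\<close> the effect of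
      evaluating the chosen field at \<open>X n\<close> rather than at \<open>\<xi> n\<close>, and
      \<open>R3\<close> the drift of the fields from \<open>X n\<close> to
      \<open>X (Suc n)\<close>.\<close>
    define R1 where "R1 = X (Suc n) - X n - h *\<^sub>R (\<Sum>i\<in>I. w n i *\<^sub>R f i (X n))"
    define R2 where "R2 = f (c n) (X n) - f (c n) (\<xi> n)"
    define R3 where "R3 = (\<Sum>i\<in>I. D (Suc n) i *\<^sub>R (f i (X (Suc n)) - f i (X n)))"
    have "(\<Sum>i\<in>I. of_bool (i = c n) *\<^sub>R f i (X n)) = f (c n) (X n)"
      using \<open>finite I\<close> c[of n]
      by (simp add: of_bool_def if_distrib[of "\<lambda>c. c *\<^sub>R _"] cong: if_cong)
    then have DS_sum: "(\<Sum>i\<in>I. D (Suc n) i *\<^sub>R f i (X n)) =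
        (\<Sum>i\<in>I. D n i *\<^sub>R f i (X n)) + (\<Sum>i\<in>I. w n i *\<^sub>R f i (X n)) - f (c n) (X n)"
      by (simp add: DS scaleR_add_left scaleR_diff_left sum.distrib sum_subtractf)
    \<comment> \<open>The increment of \<open>E\<close> cancels the averaged velocity against the
      chosen field at \<open>X n\<close>, leaving only terms controlled by Lipschitz bounds.\<close>
    have W_eq: "W (Suc n) = W n + R1 + h *\<^sub>R R2 - h *\<^sub>R R3"
      unfolding W_def E_def R1_def R2_def R3_def \<xi>S
      by (simp add: scaleR_diff_right scaleR_add_right sum_subtractf DS_sum)
    have n1: "norm R1 \<le> K * L * h\<^sup>2"
      unfolding R1_def using X2[OF that] .
    \<comment> \<open>The Lipschitz bound involves the full error, so \<open>E n\<close> is added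
      back. Of the forcing \<open>K * L * h\<^sup>2 * (2 * B + 1)\<close>, one \<open>B\<close>
      arises here, the other from \<open>R3\<close>, and the 1 from \<open>R1\<close>.\<close>
    have "norm (X n - \<xi> n) \<le> norm (W n) + B * K * h"
      using norm_triangle_ineq[of "W n" "E n"] E_bd[of n] by (simp add: W_def)
    then have "norm R2 \<le> L * (norm (W n) + B * K * h)"
      unfolding R2_def using lip[OF c] \<open>L \<ge> 0\<close> by (meson mult_left_mono order_trans)
    then have n2: "norm (h *\<^sub>R R2) \<le> h * (L * (norm (W n) + B * K * h))"
      using \<open>h \<ge> 0\<close> by (simp add: mult_left_mono)
    have "norm R3 \<le> B * (L * (K * h))"
      unfolding R3_def
    proof (rule sum_bd)
      fix i assume "i \<in> I"
      then show "norm (f i (X (Suc n)) - f i (X n)) \<le> L * (K * h)"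
        using lip X1[OF that] \<open>L \<ge> 0\<close> by (meson mult_left_mono order_trans)
    qed (use assms in simp)
    then have n3: "norm (h *\<^sub>R R3) \<le> h * (B * (L * (K * h)))"
      using \<open>h \<ge> 0\<close> by (simp add: mult_left_mono)
    have "norm (W (Suc n)) \<le> norm (W n) + norm R1 + norm (h *\<^sub>R R2) + norm (h *\<^sub>R R3)"
      unfolding W_eq by (meson add_mono norm_triangle_ineq norm_triangle_le_diff order_refl order_trans)
    also have "\<dots> \<le> norm (W n) + K * L * h\<^sup>2 + h * (L * (norm (W n) + B * K * h)) +
        h * (B * (L * (K * h)))"
      using n1 n2 n3 by simp
    finally show ?thesis
      by (simp add: algebra_simps power2_eq_square)
  qed
  have "norm (W n) \<le> (exp (L * h * n) - 1) * (K * (2 * B + 1) * h)"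
  proof (rule affine_recurrence_le[where N = N])
    show "norm (W 0) \<le> 0"
      by (simp add: W_def E_def D0 \<xi>0)
  qed (use assms \<open>B \<ge> 0\<close> W_step in auto)
  \<comment> \<open>The \<open>- 1\<close> in the bound for \<open>W n\<close> leaves room for
    exactly one copy of the constant, which absorbs \<open>E n\<close>.\<close>
  moreover have "B * K * h \<le> K * (2 * B + 1) * h"
    using assms \<open>B \<ge> 0\<close> by (simp add: algebra_simps)
  moreover have "norm (X n - \<xi> n) \<le> norm (W n) + norm (E n)"
    using norm_triangle_ineq[of "W n" "E n"] by (simp add: W_def)
  ultimately show ?thesis
    using E_bd[of n] by (simp add: algebra_simps)
qed

section \<open>Increments of solutions of the differential inclusion\<close>

lemma norm_diff_le_jacobian_bound:
  fixes f :: "real^'n \<Rightarrow> real^'m"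
  assumes "\<And>y. f differentiable (at y)" "\<And>y. matrix_op_norm (jacobian f (at y)) \<le> L"
  shows "norm (f y - f z) \<le> L * norm (y - z)"
proof (rule differentiable_bound[OF convex_UNIV])
  fix v show "(f has_derivative (\<lambda>h. jacobian f (at v) *v h)) (at v within UNIV)"
    using assms(1) by (simp add: jacobian_works)
qed (use assms(2) in \<open>auto simp: matrix_op_norm_def\<close>)

text \<open>Trades the almost everywhere condition for a null exceptional set, so that the mean
  value theorem applies to any closed convex set holding all velocities admissible along the
  interval.\<close>

lemma diff_inclusion_solution_mean_value:
  fixes x :: "real \<Rightarrow> 'a::euclidean_space"
  assumes "diff_inclusion_solution F T x0 x" "0 \<le> a" "a < b" "b \<le> T" "convex C" "closed C"
    and "\<And>t. t \<in> {a..b} \<Longrightarrow> F (x t) \<subseteq> C"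
  shows "(x b - x a) /\<^sub>R (b - a) \<in> C"
proof -
  obtain E where E: "\<And>t. t \<in> {0..T} - E \<Longrightarrow>
      \<exists>y\<in>F (x t). (x has_vector_derivative y) (at t within {0..T})"
    "E \<in> null_sets (lebesgue_on {0..T})"
    using assms(1) AE_E3 unfolding diff_inclusion_solution_def space_restrict_space
    by (smt (verit) Int_UNIV_right space_lebesgue_on)
  have "negligible E"
    using E(2) by (simp add: null_sets_restrict_space negligible_iff_null_sets)
  moreover have "abs_continuous_on a b x"
    using assms(1,2,4) abs_continuous_on_subset unfolding diff_inclusion_solution_def by blast
  moreover have "\<exists>y\<in>C. (x has_vector_derivative y) (at t within {a..b})" if t: "t \<in> {a..b} - E" for t
  proof -
    obtain y where "y \<in> F (x t)" "(x has_vector_derivative y) (at t within {0..T})"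
      using E(1)[of t] t assms(2,4) by auto
    then show ?thesis
      using assms(2,4,7) t
      by (intro bexI[of _ y]) (auto intro: has_vector_derivative_within_subset)
  qed
  ultimately show ?thesis
    using abs_continuous_mean_value_convex[OF \<open>a < b\<close>] assms(5,6) by blast
qed

lemma diff_inclusion_solution_lipschitz:
  fixes x :: "real \<Rightarrow> 'a::euclidean_space"
  assumes "diff_inclusion_solution F T x0 x" "\<And>y. F y \<subseteq> cball 0 K" "0 \<le> a" "a \<le> b" "b \<le> T"
  shows "norm (x b - x a) \<le> K * (b - a)"
proof (cases "a = b")
  case False
  then have "(x b - x a) /\<^sub>R (b - a) \<in> cball 0 K"
    using assms by (intro diff_inclusion_solution_mean_value[OF assms(1)]) auto
  then show ?thesis
    using assms(4) False unfolding mem_cball_0 norm_scaleR by (simp add: field_simps)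
qed simp

lemma diff_inclusion_solution_averaged_step:
  fixes x :: "real \<Rightarrow> 'a::euclidean_space"
  assumes sol: "diff_inclusion_solution (\<lambda>y. (\<lambda>i. f i y) ` I) T x0 x"
    and "finite I" "L \<ge> 0" "K \<ge> 0" "0 \<le> a" "a < b" "b \<le> T"
    and bd: "\<And>i y. i \<in> I \<Longrightarrow> norm (f i y) \<le> K"
    and lip: "\<And>i y z. i \<in> I \<Longrightarrow> norm (f i y - f i z) \<le> L * norm (y - z)"
  shows "\<exists>w. (\<forall>i\<in>I. w i \<ge> (0::real)) \<and> sum w I = 1 \<and>
    norm (x b - x a - (b - a) *\<^sub>R (\<Sum>i\<in>I. w i *\<^sub>R f i (x a))) \<le> K * L * (b - a)\<^sup>2"
proof -
  \<comment> \<open>The curve moves by at most \<open>K * (b - a)\<close>, hence each field along it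
    by at most \<open>L\<close> times that.\<close>
  define r where "r = L * (K * (b - a))"
  \<comment> \<open>The Minkowski sum of the hull and a ball; both are compact and convex, so the
    sum is closed and convex.\<close>
  define C where "C = (\<Union>p\<in>convex hull ((\<lambda>i. f i (x a)) ` I). \<Union>q\<in>cball 0 r. {p + q})"
  have "convex C"
    unfolding C_def by (intro convex_sums) auto
  moreover have "closed C"
    unfolding C_def using \<open>finite I\<close>
    by (intro compact_imp_closed compact_sums' finite_imp_compact_convex_hull) auto
  moreover have "(\<lambda>i. f i (x t)) ` I \<subseteq> C" if t: "t \<in> {a..b}" for t
  proof clarify
    fix i assume i: "i \<in> I"
    have "norm (x t - x a) \<le> K * (t - a)"
      using bd t assms(5-7) by (intro diff_inclusion_solution_lipschitz[OF sol]) auto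
    also have "\<dots> \<le> K * (b - a)"
      using t \<open>K \<ge> 0\<close> by (intro mult_left_mono) auto
    finally have "norm (f i (x t) - f i (x a)) \<le> r"
      unfolding r_def using lip[OF i] \<open>L \<ge> 0\<close> by (meson mult_left_mono order_trans)
    then have "f i (x t) \<in> (\<Union>q\<in>cball 0 r. {f i (x a) + q})"
      by (intro UN_I[of "f i (x t) - f i (x a)"]) auto
    moreover have "f i (x a) \<in> convex hull ((\<lambda>i. f i (x a)) ` I)"
      using i by (intro hull_inc) auto
    ultimately show "f i (x t) \<in> C"
      unfolding C_def by (rule UN_I[rotated])
  qed
  ultimately have "(x b - x a) /\<^sub>R (b - a) \<in> C"
    using assms(5-7) by (intro diff_inclusion_solution_mean_value[OF sol]) auto
  then obtain p q where pq: "p \<in> convex hull ((\<lambda>i. f i (x a)) ` I)" "norm q \<le> r"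
    "(x b - x a) /\<^sub>R (b - a) = p + q"
    unfolding C_def by auto
  obtain w where w: "\<And>i. i \<in> I \<Longrightarrow> w i \<ge> (0::real)" "sum w I = 1"
    "p = (\<Sum>i\<in>I. w i *\<^sub>R f i (x a))"
    using in_convex_hull_image_weights[OF \<open>finite I\<close> pq(1)] by blast
  have "x b - x a = (b - a) *\<^sub>R ((x b - x a) /\<^sub>R (b - a))"
    using \<open>a < b\<close> by simp
  also have "\<dots> = (b - a) *\<^sub>R (p + q)"
    by (simp only: pq(3))
  finally have "x b - x a - (b - a) *\<^sub>R p = (b - a) *\<^sub>R q"
    by (simp add: scaleR_add_right)
  moreover have "norm ((b - a) *\<^sub>R q) \<le> (b - a) * r"
    using pq(2) \<open>a < b\<close> by (simp add: mult_left_mono)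
  moreover have "(b - a) * r = K * L * (b - a)\<^sup>2"
    by (simp add: r_def power2_eq_square)
  ultimately have "norm (x b - x a - (b - a) *\<^sub>R (\<Sum>i\<in>I. w i *\<^sub>R f i (x a))) \<le> K * L * (b - a)\<^sup>2"
    by (simp add: w(3))
  then show ?thesis
    using w(1,2) by blast
qed

section \<open>Construction of the Euler sequence\<close>

lemma euler_approximation_of_diff_inclusion:
  fixes x :: "real \<Rightarrow> 'a::euclidean_space"
  assumes sol: "diff_inclusion_solution (\<lambda>y. (\<lambda>i. f i y) ` I) T x0 x"
    and I: "finite I" "I \<noteq> {}" and "L \<ge> 0" "K \<ge> 0" "T > 0" "N > 0"
    and bd: "\<And>i y. i \<in> I \<Longrightarrow> norm (f i y) \<le> K"
    and lip: "\<And>i y z. i \<in> I \<Longrightarrow> norm (f i y - f i z) \<le> L * norm (y - z)"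
  obtains \<xi> where "forward_euler_solution (\<lambda>y. (\<lambda>i. f i y) ` I) (T / real N) N x0 \<xi>"
    "\<And>n. n \<le> N \<Longrightarrow> norm (x (real n * (T / real N)) - \<xi> n)
      \<le> exp (L * T) * (K * (4 * real (card I) - 3) * (T / real N))"
proof -
  define h where "h = T / real N"
  have "h > 0" "real N * h = T"
    using \<open>T > 0\<close> \<open>N > 0\<close> by (auto simp: h_def)
  have h_le: "real n * h \<le> T" if "n \<le> N" for n
    using that \<open>h > 0\<close> \<open>real N * h = T\<close> by (metis less_imp_le mult_right_mono of_nat_mono)
  define X where "X n = x (real n * h)" for n
  have step: "real (Suc n) * h - real n * h = h" for n
    by (simp add: algebra_simps)
  obtain j where "j \<in> I"
    using I by blast
  \<comment> \<open>The rounding lemma wants weights for every \<open>n\<close>; beyond the mesh a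
    unit vector at \<open>j\<close> serves as default.\<close>
  have "\<exists>w. (\<forall>i\<in>I. w i \<ge> 0) \<and> sum w I = 1 \<and> (n < N \<longrightarrow>
      norm (X (Suc n) - X n - h *\<^sub>R (\<Sum>i\<in>I. w i *\<^sub>R f i (X n))) \<le> K * L * h\<^sup>2)" for n
  proof (cases "n < N")
    case True
    have "0 \<le> real n * h" "real n * h < real (Suc n) * h" "real (Suc n) * h \<le> T"
      using h_le[of "Suc n"] \<open>h > 0\<close> True by auto
    note diff_inclusion_solution_averaged_step[OF sol I(1) \<open>L \<ge> 0\<close> \<open>K \<ge> 0\<close> this bd lip]
    then show ?thesis
      unfolding step X_def by blast
  next
    case False
    then show ?thesis
      using I \<open>j \<in> I\<close> by (intro exI[of _ "\<lambda>i. of_bool (i = j)"]) (auto simp: of_bool_def)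
  qed
  then obtain w where w: "\<And>n i. i \<in> I \<Longrightarrow> w n i \<ge> (0::real)" "\<And>n. sum (w n) I = 1"
    "\<And>n. n < N \<Longrightarrow> norm (X (Suc n) - X n - h *\<^sub>R (\<Sum>i\<in>I. w n i *\<^sub>R f i (X n))) \<le> K * L * h\<^sup>2"
    by metis
  obtain c D where cD: "\<And>n. c n \<in> I" "\<And>i. D 0 i = 0"
    "\<And>n i. D (Suc n) i = D n i + w n i - of_bool (i = c n)"
    "\<And>n. (\<Sum>i\<in>I. \<bar>D n i\<bar>) \<le> 2 * (real (card I) - 1)"
    using greedy_rounding[where w = w, OF I w(1,2)] by metis
  define \<xi> where "\<xi> = rec_nat x0 (\<lambda>n y. y + h *\<^sub>R f (c n) y)"
  have \<xi>0: "\<xi> 0 = x0" and \<xi>S: "\<And>n. \<xi> (Suc n) = \<xi> n + h *\<^sub>R f (c n) (\<xi> n)"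
    by (simp_all add: \<xi>_def)
  have X0: "\<xi> 0 = X 0"
    using sol by (simp add: \<xi>0 X_def diff_inclusion_solution_def)
  have X1: "norm (X (Suc n) - X n) \<le> K * h" if "n < N" for n
    using diff_inclusion_solution_lipschitz[OF sol, of K "real n * h" "real (Suc n) * h"]
      bd h_le[of "Suc n"] \<open>h > 0\<close> that unfolding step X_def by force
  have "norm (X n - \<xi> n) \<le> exp (L * T) * (K * (4 * real (card I) - 3) * h)" if "n \<le> N" for n
  proof -
    \<comment> \<open>Rounding supplies \<open>B = 2 * (card I - 1)\<close>, so
      \<open>2 * B + 1\<close> becomes \<open>4 * card I - 3\<close>.\<close>
    have "norm (X n - \<xi> n) \<le> exp (L * h * n) * (K * (2 * (2 * (real (card I) - 1)) + 1) * h)"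
      using euler_discrepancy_error[where c = c and D = D and w = w,
          OF I(1) _ \<open>L \<ge> 0\<close> \<open>K \<ge> 0\<close> bd lip cD X1 w(3) X0 \<xi>S that] \<open>h > 0\<close> by simp
    also have "2 * (2 * (real (card I) - 1)) + 1 = 4 * real (card I) - 3"
      by simp
    also have "exp (L * h * n) * (K * (4 * real (card I) - 3) * h) \<le>
        exp (L * T) * (K * (4 * real (card I) - 3) * h)"
    proof (rule mult_right_mono)
      show "exp (L * h * n) \<le> exp (L * T)"
        using h_le[OF that] \<open>L \<ge> 0\<close> by (simp add: mult_left_mono mult.assoc mult.commute[of h])
      have "real (card I) \<ge> 1"
        using I by (simp add: Suc_leI card_gt_0_iff)
      then show "0 \<le> K * (4 * real (card I) - 3) * h"
        using \<open>K \<ge> 0\<close> \<open>h > 0\<close> by simp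
    qed
    finally show ?thesis .
  qed
  moreover have "forward_euler_solution (\<lambda>y. (\<lambda>i. f i y) ` I) h N x0 \<xi>"
    using cD(1) by (auto simp: forward_euler_solution_def \<xi>0 \<xi>S)
  ultimately show thesis
    using that unfolding X_def h_def by blast
qed

section \<open>Comparison with the stated bound\<close>

theorem theorem2p3:
  fixes T \<Delta>t K L S :: real
    and N M :: nat
    and x0 :: "real^'d"
    and f :: "nat \<Rightarrow> real^'d \<Rightarrow> real^'d"
    and F :: "real^'d \<Rightarrow> (real^'d) set"
    and x :: "real \<Rightarrow> real^'d"
  assumes "T > 0" and "N > 0" and "\<Delta>t = T / real N"
    and "M \<ge> CARD('d) + 1"
    and "K \<ge> 0" and "L > 0" and "S > 0"
    and "\<And>i y. i \<in> {1..M} \<Longrightarrow> f i differentiable (at y)"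
    and "\<And>i y z. i \<in> {1..M} \<Longrightarrow>
           norm (f i y - f i z - jacobian (f i) (at z) *v (y - z)) \<le> S * (norm (y - z))\<^sup>2"
    and "\<And>i y. i \<in> {1..M} \<Longrightarrow> norm (f i y) \<le> K"
    and "\<And>i y. i \<in> {1..M} \<Longrightarrow> matrix_op_norm (jacobian (f i) (at y)) \<le> L"
    and "F = (\<lambda>y. {f i y | i. i \<in> {1..M}})"
    and "diff_inclusion_solution F T x0 x"
  shows "\<exists>\<xi> :: nat \<Rightarrow> real^'d.
    forward_euler_solution F \<Delta>t N x0 \<xi> \<and>
    (MAX n\<in>{0..N}. norm (x (real n * \<Delta>t) - \<xi> n)) \<le>
      (exp (L * T) * (K * L * T + K * (8 * real M - 10)) + 2 * K * (real M - 1)) * \<Delta>t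
      + exp (L * T) *
        (K * L * (real M - 1) * (real M - 2)
         + 2 * K * L * (((real M - 1) ^ 3 - (real M - 1)) / 3) * (1 + L * \<Delta>t) powi (int M - 3)
         + 2 * S * K\<^sup>2 * (real M * (real M - 1) * (2 * real M - 1) / (3 * L))) * \<Delta>t\<^sup>2"
proof -
  have F: "F = (\<lambda>y. (\<lambda>i. f i y) ` {1..M})"
    unfolding assms(12) by (intro ext) blast
  have M: "real M \<ge> 2"
    using assms(4) zero_less_card_finite[where 'a = 'd] by linarith
  have lip: "norm (f i y - f i z) \<le> L * norm (y - z)" if "i \<in> {1..M}" for i y z
    using assms(8,11) that by (intro norm_diff_le_jacobian_bound) auto
  obtain \<xi> where \<xi>: "forward_euler_solution F \<Delta>t N x0 \<xi>"
    and err: "\<And>n. n \<le> N \<Longrightarrow> norm (x (real n * \<Delta>t) - \<xi> n)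
      \<le> exp (L * T) * (K * (4 * real M - 3) * \<Delta>t)"
    using euler_approximation_of_diff_inclusion[where f = f and I = "{1..M}" and L = L,
        OF assms(13)[unfolded F] _ _ _ assms(5,1,2,10) lip] assms(6) M
    unfolding F assms(3) by auto
  have "\<Delta>t > 0"
    using assms by simp
  let ?P = "K * L * (real M - 1) * (real M - 2)
    + 2 * K * L * (((real M - 1) ^ 3 - (real M - 1)) / 3) * (1 + L * \<Delta>t) powi (int M - 3)
    + 2 * S * K\<^sup>2 * (real M * (real M - 1) * (2 * real M - 1) / (3 * L))"
  \<comment> \<open>This makes the cubic factor of \<open>?P\<close> nonnegative. The exponent
    \<open>int M - 3\<close> is negative for \<open>M = 2\<close>, but the base is positive.\<close>
  have "(real M - 1) ^ 1 \<le> (real M - 1) ^ 3"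
    using M by (intro power_increasing) auto
  then have P: "?P \<ge> 0"
    using assms(5-7) M \<open>\<Delta>t > 0\<close>
    by (intro add_nonneg_nonneg mult_nonneg_nonneg divide_nonneg_nonneg zero_le_power_int) auto
  have "exp (L * T) * (K * (4 * real M - 3)) \<le>
      exp (L * T) * (K * L * T + K * (8 * real M - 10)) + 2 * K * (real M - 1)"
  proof -
    \<comment> \<open>The comparison amounts to \<open>4 * M \<ge> 7\<close>, which follows from
      \<open>M \<ge> 2\<close>.\<close>
    have "K * (4 * real M - 3) \<le> K * (8 * real M - 10)"
      using assms(5) M by (intro mult_left_mono) auto
    then have "K * (4 * real M - 3) \<le> K * L * T + K * (8 * real M - 10)"
      using assms(1,5,6) by (simp add: add_increasing)
    then have "exp (L * T) * (K * (4 * real M - 3)) \<le>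
        exp (L * T) * (K * L * T + K * (8 * real M - 10))"
      by (intro mult_left_mono) auto
    moreover have "0 \<le> 2 * K * (real M - 1)"
      using assms(5) M by simp
    ultimately show ?thesis
      by (rule add_increasing2[rotated])
  qed
  then have "exp (L * T) * (K * (4 * real M - 3)) * \<Delta>t \<le>
      (exp (L * T) * (K * L * T + K * (8 * real M - 10)) + 2 * K * (real M - 1)) * \<Delta>t"
    using \<open>\<Delta>t > 0\<close> by (intro mult_right_mono) auto
  moreover have "0 \<le> exp (L * T) * ?P * \<Delta>t\<^sup>2"
    using P by simp
  ultimately have "exp (L * T) * (K * (4 * real M - 3) * \<Delta>t) \<le>
      (exp (L * T) * (K * L * T + K * (8 * real M - 10)) + 2 * K * (real M - 1)) * \<Delta>t
      + exp (L * T) * ?P * \<Delta>t\<^sup>2"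
    by (simp only: mult.assoc)
  moreover have "(MAX n\<in>{0..N}. norm (x (real n * \<Delta>t) - \<xi> n)) \<le>
      exp (L * T) * (K * (4 * real M - 3) * \<Delta>t)"
    using err by (intro Max.boundedI) auto
  ultimately show ?thesis
    using \<xi> by (meson order_trans)
qed

end
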